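(* Let $\nu\ge0$ and let $(a_+,a_-)$, with drift $V$, be a smooth solution on $\mathbb R\times[0,T)$ of $$(a_\pm)_t+V(a_\pm)_x=a_\pm^2+\nu(a_\pm)_{xx},\qquad V_x=a_++a_-,\qquad V(0,t)=0,$$ such that for every $t\in[0,T)$ both $a_+(\cdot,t)$ and $a_-(\cdot,t)$ are even, nonnegative, and nonincreasing on $(0,\infty)$. Then for every real $p\ge1$ and $j\in\{+,-\}$, with $k$ denoting the other sign, $$\frac{d}{dt}\int_{\mathbb R}a_j^p\,dx+\nu p(p-1)\int_{\mathbb R}a_j^{p-2}(a_j)_x^2\,dx=(p+1)\int_{\mathbb R}a_j^{p+1}\,dx+\int_{\mathbb R}a_ka_j^p\,dx .$$ In particular, $$\frac{d}{dt}\int_{\mathbb R}a_j\,dx=2\int_{\mathbb R}a_j^2\,dx+\int_{\mathbb R}a_ja_k\,dx .$$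
   Context: Solutions are those arising from $C_c^\infty(\mathbb R)$ initial data: $a_\pm$ and their derivatives decay rapidly as $|x|\to\infty$, uniformly on compact time subintervals of $[0,T)$. Convention: the term $\nu p(p-1)\int a_j^{p-2}(a_j)_x^2$ is read as $0$ if $p=1$ or $\nu=0$, and its integrand is read as $0$ at points where $a_j=0$. *)

theory Defs
  imports "HOL-Analysis.Analysis"
begin

datatype sign = Plus | Minus

text \<open>Functions of space and time are written \<open>f x t\<close>. The right end point of the time
  interval may be infinite.\<close>

definition time_interval :: "ereal \<Rightarrow> real set" where
  "time_interval T = {t. 0 \<le> t \<and> ereal t < T}"

definition ddx :: "(real \<Rightarrow> real \<Rightarrow> real) \<Rightarrow> real \<Rightarrow> real \<Rightarrow> real" where
  "ddx f = (\<lambda>x t. deriv (\<lambda>y. f y t) x)"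

text \<open>The time derivative is taken relative to the time interval \<open>I\<close>, hence is one-sided at its
  left end point, and does not depend on the values of \<open>f\<close> outside \<open>I\<close>.\<close>

definition ddt :: "real set \<Rightarrow> (real \<Rightarrow> real \<Rightarrow> real) \<Rightarrow> real \<Rightarrow> real \<Rightarrow> real" where
  "ddt I f = (\<lambda>x t. vector_derivative (\<lambda>s. f x s) (at t within I))"

primrec C_diff :: "nat \<Rightarrow> real set \<Rightarrow> (real \<Rightarrow> real \<Rightarrow> real) \<Rightarrow> bool" where
  "C_diff 0 I f \<longleftrightarrow> continuous_on (UNIV \<times> I) (\<lambda>(x, t). f x t)"
| "C_diff (Suc n) I f \<longleftrightarrow>
     continuous_on (UNIV \<times> I) (\<lambda>(x, t). f x t) \<and>
     (\<forall>x. \<forall>t\<in>I. (\<lambda>y. f y t) differentiable (at x) \<and>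
                  (\<lambda>s. f x s) differentiable (at t within I)) \<and>
     C_diff n I (ddx f) \<and> C_diff n I (ddt I f)"

definition smooth_on_strip :: "real set \<Rightarrow> (real \<Rightarrow> real \<Rightarrow> real) \<Rightarrow> bool" where
  "smooth_on_strip I f \<longleftrightarrow> (\<forall>n. C_diff n I f)"

definition rapidly_decaying :: "real set \<Rightarrow> (real \<Rightarrow> real \<Rightarrow> real) \<Rightarrow> bool" where
  "rapidly_decaying I f \<longleftrightarrow>
     (\<forall>l m N. \<forall>K. compact K \<and> K \<subseteq> I \<longrightarrow>
        (\<exists>C. \<forall>x. \<forall>t\<in>K. \<bar>x\<bar> ^ N * \<bar>((ddt I ^^ l) ((ddx ^^ m) f)) x t\<bar> \<le> C))"

definition smooth_solution ::
  "real \<Rightarrow> ereal \<Rightarrow> (sign \<Rightarrow> real \<Rightarrow> real \<Rightarrow> real) \<Rightarrow> (real \<Rightarrow> real \<Rightarrow> real) \<Rightarrow> bool" where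
  "smooth_solution \<nu> T a V \<longleftrightarrow>
     (\<forall>j. smooth_on_strip (time_interval T) (a j) \<and>
          compact (closure {x. a j x 0 \<noteq> 0}) \<and>
          rapidly_decaying (time_interval T) (a j)) \<and>
     (\<forall>t\<in>time_interval T.
        V 0 t = 0 \<and>
        (\<forall>x. ((\<lambda>y. V y t) has_real_derivative (a Plus x t + a Minus x t)) (at x)) \<and>
        (\<forall>j x. ddt (time_interval T) (a j) x t + V x t * ddx (a j) x t
                = (a j x t)\<^sup>2 + \<nu> * ddx (ddx (a j)) x t))"

text \<open>The integrand of the dissipation term, and the term itself, with the conventions that the
  integrand vanishes where \<open>f\<close> does and the term vanishes for \<open>p = 1\<close> or \<open>\<nu> = 0\<close> (even
  if the integrand is not integrable).\<close>

definition dissipation_density :: "real \<Rightarrow> (real \<Rightarrow> real) \<Rightarrow> real \<Rightarrow> real" where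
  "dissipation_density p f x =
     (if f x = 0 then 0 else f x powr (p - 2) * (deriv f x)\<^sup>2)"

definition dissipation :: "real \<Rightarrow> real \<Rightarrow> (real \<Rightarrow> real) \<Rightarrow> real" where
  "dissipation \<nu> p f =
     (if p = 1 \<or> \<nu> = 0 then 0
      else \<nu> * p * (p - 1) * (\<integral>x. dissipation_density p f x \<partial>lborel))"

end

theory Submission
  imports Defs "HOL-Probability.Sinc_Integral"
begin

text \<open>
  Differentiating under the integral sign and inserting the equation, with \<open>f\<close> and \<open>g\<close> for the two
  components at a fixed time, the derivative of \<open>\<integral> f\<^sup>p\<close> is
  \<open>p \<integral> f\<^sup>p\<^sup>+\<^sup>1 - \<integral> V (f\<^sup>p)\<^sub>x + \<nu> p \<integral> f\<^sup>p\<^sup>-\<^sup>1 f\<^sub>x\<^sub>x\<close>.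
  Since \<open>V\<^sub>x = f + g\<close>, integrating by parts turns \<open>- \<integral> V (f\<^sup>p)\<^sub>x\<close> into
  \<open>\<integral> f\<^sup>p\<^sup>+\<^sup>1 + \<integral> g f\<^sup>p\<close>; as \<open>V\<close> grows at most linearly and \<open>f\<close> decays rapidly, there is no
  boundary term (\<open>integral_transport\<close>). The same integration by parts produces the dissipation from
  the viscous integral.

  The delicate point is that \<open>f\<close> may vanish. The function \<open>y \<mapsto> y\<^sup>p\<close> is still continuously
  differentiable on the closed half line \<open>[0, \<infinity>)\<close> when \<open>p \<ge> 1\<close>, and this suffices for the time
  derivative (\<open>has_real_derivative_integral_powr\<close>) and the transport term. For the viscous term with
  \<open>1 < p < 2\<close>, however, \<open>f\<^sup>p\<^sup>-\<^sup>1\<close> need not be differentiable, and integrability of the dissipation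
  density is part of the claim. There \<open>f\<close> is replaced by \<open>f + \<epsilon>\<close>, for which everything is smooth, and
  \<open>\<epsilon>\<close> tends to zero: the densities \<open>(f + \<epsilon>)\<^sup>p\<^sup>-\<^sup>2 f\<^sub>x\<^sup>2\<close> increase to the dissipation density, because
  \<open>f\<^sub>x = 0\<close> wherever the nonnegative function \<open>f\<close> vanishes, while their integrals stay bounded
  (\<open>integral_viscous\<close>).
\<close>

section \<open>Differentiation under the integral sign\<close>

text \<open>The mean value theorem on the convex set \<open>S\<close> bounds all difference quotients by \<open>B\<close>, so dominated
  convergence applies along every sequence approaching \<open>t\<close>. The derivatives are relative to \<open>S\<close>, which
  covers one-sided derivatives at the end points of an interval.\<close>

lemma has_real_derivative_integral_dominated:
  fixes F F' :: "'a \<Rightarrow> real \<Rightarrow> real"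
  assumes "convex S" and t: "t \<in> S"
    and deriv: "\<And>x s. s \<in> S \<Longrightarrow> (F x has_real_derivative F' x s) (at s within S)"
    and int: "\<And>s. s \<in> S \<Longrightarrow> integrable M (\<lambda>x. F x s)"
    and meas: "(\<lambda>x. F' x t) \<in> borel_measurable M"
    and bound: "\<And>x s. s \<in> S \<Longrightarrow> \<bar>F' x s\<bar> \<le> B x"
    and B: "integrable M B"
  shows "((\<lambda>s. \<integral>x. F x s \<partial>M) has_real_derivative (\<integral>x. F' x t \<partial>M)) (at t within S)"
  unfolding has_field_derivative_iff tendsto_at_iff_sequentially
proof (intro allI impI)
  fix X :: "nat \<Rightarrow> real"
  assume X: "\<forall>i. X i \<in> S - {t}" and lim: "X \<longlonglongrightarrow> t"
  define q where "q = (\<lambda>i x. (F x (X i) - F x t) / (X i - t))"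
  have XS: "X i \<in> S" "X i \<noteq> t" for i
    using X by auto
  have int_q: "integrable M (q i)" for i
    unfolding q_def using XS t by (intro integrable_divide_zero Bochner_Integration.integrable_diff int) auto
  have "(\<lambda>i. \<integral>x. q i x \<partial>M) \<longlonglongrightarrow> (\<integral>x. F' x t \<partial>M)"
  proof (rule integral_dominated_convergence[where w = B])
    show "AE x in M. (\<lambda>i. q i x) \<longlonglongrightarrow> F' x t"
    proof (rule AE_I2)
      fix x
      show "(\<lambda>i. q i x) \<longlonglongrightarrow> F' x t"
        using deriv[OF t, of x] X lim
        unfolding has_field_derivative_iff tendsto_at_iff_sequentially q_def comp_def by blast
    qed
    fix i
    show "AE x in M. norm (q i x) \<le> B x"
    proof (rule AE_I2)
      fix x
      have "norm (F x (X i) - F x t) \<le> B x * norm (X i - t)"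
        by (rule field_differentiable_bound[OF \<open>convex S\<close>, where f' = "F' x"])
          (use deriv bound XS t in auto)
      then show "norm (q i x) \<le> B x"
        using XS(2)[of i] by (simp add: q_def divide_le_eq)
    qed
  qed (use B meas int_q in auto)
  moreover have "(\<integral>x. q i x \<partial>M)
      = ((\<integral>x. F x (X i) \<partial>M) - (\<integral>x. F x t \<partial>M)) / (X i - t)" for i
    unfolding q_def using int XS t by simp
  ultimately show "((\<lambda>s. ((\<integral>x. F x s \<partial>M) - (\<integral>x. F x t \<partial>M)) / (s - t)) \<circ> X)
      \<longlonglongrightarrow> (\<integral>x. F' x t \<partial>M)"
    by (simp add: comp_def)
qed

section \<open>Real powers of nonnegative functions\<close>

text \<open>The derivative of \<open>z powr p\<close> on \<open>{0..}\<close>. For \<open>p = 1\<close> it is the constant one, which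
  \<open>p * y powr (p - 1)\<close> misses at \<open>y = 0\<close> because \<open>0 powr 0 = 0\<close>.\<close>

definition powr_slope :: "real \<Rightarrow> real \<Rightarrow> real" where
  "powr_slope p y = (if p = 1 then 1 else p * y powr (p - 1))"

lemma powr_slope_nonneg: "1 \<le> p \<Longrightarrow> 0 \<le> powr_slope p y"
  by (simp add: powr_slope_def)

lemma powr_slope_mono: "1 \<le> p \<Longrightarrow> 0 \<le> y \<Longrightarrow> y \<le> z \<Longrightarrow> powr_slope p y \<le> powr_slope p z"
  by (auto simp: powr_slope_def intro!: mult_left_mono powr_mono2)

lemma continuous_on_powr_slope:
  assumes "1 \<le> p" "continuous_on A f" "\<And>x. x \<in> A \<Longrightarrow> 0 \<le> f x"
  shows "continuous_on A (\<lambda>x. powr_slope p (f x))"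
  unfolding powr_slope_def using assms
  by (cases "p = 1") (auto intro!: continuous_on_mult continuous_on_powr' continuous_on_const)

lemma has_real_derivative_powr_nonneg:
  assumes "1 \<le> p" "0 \<le> y"
  shows "((\<lambda>z. z powr p) has_real_derivative powr_slope p y) (at y within {0..})"
proof (cases "p = 1")
  case True
  have "((\<lambda>z. z) has_real_derivative 1) (at y within {0..})"
    by (rule DERIV_ident)
  then have "((\<lambda>z. z powr 1) has_real_derivative 1) (at y within {0..})"
    by (rule has_field_derivative_transform_within[where d = 1]) (use assms in auto)
  then show ?thesis
    using True by (simp add: powr_slope_def)
next
  case False
  then have p: "p > 1"
    using assms by simp
  show ?thesis
  proof (cases "y = 0")
    case True
    have "((\<lambda>z. z powr (p - 1)) \<longlongrightarrow> 0) (at (0::real) within {0..})"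
      by (rule tendsto_zero_powrI)
        (use p in \<open>auto intro!: tendsto_eq_intros simp: eventually_at_filter\<close>)
    then have "((\<lambda>z. (z powr p - 0 powr p) / (z - 0)) \<longlongrightarrow> 0) (at (0::real) within {0..})"
      by (rule Lim_transform_eventually)
        (auto simp: eventually_at_filter powr_diff)
    then show ?thesis
      using True p unfolding has_field_derivative_iff by (simp add: powr_slope_def)
  next
    case y: False
    then show ?thesis
      using assms False has_real_derivative_powr[of y p]
      by (auto simp: powr_slope_def intro: has_field_derivative_at_within)
  qed
qed

text \<open>The inner function takes its values in \<open>{0..}\<close>, so the one-sided derivative of \<open>z powr p\<close> at zero
  is enough even where \<open>u\<close> vanishes.\<close>

lemma has_real_derivative_powr_chain:
  assumes "1 \<le> p" "(u has_real_derivative d) (at s within S)" "s \<in> S"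
    and "\<And>r. r \<in> S \<Longrightarrow> 0 \<le> u r"
  shows "((\<lambda>r. u r powr p) has_real_derivative powr_slope p (u s) * d) (at s within S)"
proof -
  have "((\<lambda>z. z powr p) has_real_derivative powr_slope p (u s)) (at (u s) within u ` S)"
    by (rule has_field_derivative_subset[OF has_real_derivative_powr_nonneg]) (use assms in auto)
  from DERIV_image_chain[OF this assms(2)] show ?thesis
    by (simp add: comp_def)
qed

section \<open>Rapidly decaying functions on the line\<close>

text \<open>Unlike for Schwartz functions, nothing is asked of the derivatives: powers of a solution need not
  be smooth.\<close>

definition decays :: "(real \<Rightarrow> real) \<Rightarrow> bool" where
  "decays h \<longleftrightarrow> (\<forall>N. \<exists>C. \<forall>x. \<bar>x\<bar> ^ N * \<bar>h x\<bar> \<le> C)"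

lemma decays_bounded:
  assumes "decays h"
  obtains C where "C \<ge> 0" "\<And>x. \<bar>h x\<bar> \<le> C"
proof -
  obtain C where C: "\<And>x. \<bar>x\<bar> ^ 0 * \<bar>h x\<bar> \<le> C"
    using assms unfolding decays_def by blast
  show thesis
    using that[of C] C[of 0] C by force
qed

text \<open>Needed for the drift, which is unbounded but at most linear. The extra factor \<open>\<bar>x\<bar>\<close> only
  raises the order of the moment of \<open>h\<close>.\<close>

lemma decays_mult_linear_growth:
  assumes "decays h" and w: "\<And>x. \<bar>w x\<bar> \<le> M * (1 + \<bar>x\<bar>)"
  shows "decays (\<lambda>x. w x * h x)"
  unfolding decays_def
proof
  fix N
  obtain C D where C: "\<And>x. \<bar>x\<bar> ^ N * \<bar>h x\<bar> \<le> C" and D: "\<And>x. \<bar>x\<bar> ^ Suc N * \<bar>h x\<bar> \<le> D"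
    using assms(1) unfolding decays_def by meson
  have M: "0 \<le> M"
    using w[of 0] by simp
  have "\<bar>x\<bar> ^ N * \<bar>w x * h x\<bar> \<le> M * (C + D)" for x
  proof -
    have "\<bar>x\<bar> ^ N * \<bar>w x * h x\<bar> = \<bar>w x\<bar> * (\<bar>x\<bar> ^ N * \<bar>h x\<bar>)"
      by (simp add: abs_mult)
    also have "\<dots> \<le> (M * (1 + \<bar>x\<bar>)) * (\<bar>x\<bar> ^ N * \<bar>h x\<bar>)"
      by (intro mult_right_mono w) simp
    also have "\<dots> = M * (\<bar>x\<bar> ^ N * \<bar>h x\<bar> + \<bar>x\<bar> ^ Suc N * \<bar>h x\<bar>)"
      by (simp add: algebra_simps)
    also have "\<dots> \<le> M * (C + D)"
      by (intro mult_left_mono add_mono C D M)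
    finally show ?thesis .
  qed
  then show "\<exists>C. \<forall>x. \<bar>x\<bar> ^ N * \<bar>w x * h x\<bar> \<le> C"
    by blast
qed

lemma decays_mult_bounded:
  assumes "decays h" "\<And>x. \<bar>w x\<bar> \<le> M"
  shows "decays (\<lambda>x. w x * h x)"
proof (rule decays_mult_linear_growth[OF assms(1)])
  fix x
  have "M \<ge> 0"
    using assms(2)[of 0] by simp
  then show "\<bar>w x\<bar> \<le> M * (1 + \<bar>x\<bar>)"
    using assms(2)[of x] mult_nonneg_nonneg[of M "\<bar>x\<bar>"] unfolding distrib_left by linarith
qed

lemma integrable_inverse_1_plus_square_lborel:
  "integrable lborel (\<lambda>x. C * inverse (1 + x\<^sup>2) :: real)"
  using integrable_inverse_1_plus_square
  by (intro integrable_mult_right) (simp add: set_integrable_def)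

text \<open>Turns two moment bounds into a bound by an integrable function.\<close>

lemma le_inverse_1_plus_square:
  fixes x y :: real
  assumes "\<bar>x\<bar> ^ 0 * \<bar>y\<bar> \<le> C" "\<bar>x\<bar> ^ 2 * \<bar>y\<bar> \<le> D"
  shows "\<bar>y\<bar> \<le> (C + D) * inverse (1 + x\<^sup>2)"
proof -
  have "0 < 1 + x\<^sup>2"
    by (simp add: add_pos_nonneg)
  then show ?thesis
    using assms by (simp add: field_simps)
qed

lemma decays_integrable:
  assumes "decays h" "continuous_on UNIV h"
  shows "integrable lborel h"
proof -
  obtain C D where "\<And>x. \<bar>x\<bar> ^ 0 * \<bar>h x\<bar> \<le> C" "\<And>x. \<bar>x\<bar> ^ 2 * \<bar>h x\<bar> \<le> D"
    using assms(1) unfolding decays_def by meson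
  then have "\<bar>h x\<bar> \<le> (C + D) * inverse (1 + x\<^sup>2)" for x
    by (rule le_inverse_1_plus_square)
  moreover have "h \<in> borel_measurable lborel"
    using borel_measurable_continuous_onI[OF assms(2)] by simp
  ultimately show ?thesis
    by (intro Bochner_Integration.integrable_bound[OF integrable_inverse_1_plus_square_lborel[of "C + D"]])
      (auto intro: order_trans[OF _ abs_ge_self])
qed

text \<open>The first moment bound gives \<open>\<bar>h x\<bar> \<le> C / \<bar>x\<bar>\<close>.\<close>

lemma decays_tendsto_0:
  assumes "decays h"
  shows "(h \<longlongrightarrow> 0) at_top" "(h \<longlongrightarrow> 0) at_bot"
proof -
  obtain C where C: "\<And>x. \<bar>x\<bar> ^ 1 * \<bar>h x\<bar> \<le> C"
    using assms unfolding decays_def by meson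
  have bound: "norm (h x) \<le> C / \<bar>x\<bar>" if "x \<noteq> 0" for x
    using C[of x] that by (simp add: field_simps)
  show "(h \<longlongrightarrow> 0) at_top"
  proof (rule Lim_null_comparison)
    show "\<forall>\<^sub>F x in at_top. norm (h x) \<le> C / \<bar>x\<bar>"
      using eventually_gt_at_top[of 0] by eventually_elim (rule bound, simp)
    show "((\<lambda>x::real. C / \<bar>x\<bar>) \<longlongrightarrow> 0) at_top"
      by real_asymp
  qed
  show "(h \<longlongrightarrow> 0) at_bot"
  proof (rule Lim_null_comparison)
    show "\<forall>\<^sub>F x in at_bot. norm (h x) \<le> C / \<bar>x\<bar>"
      using eventually_gt_at_bot[of 0] by eventually_elim (rule bound, simp)
    show "((\<lambda>x::real. C / \<bar>x\<bar>) \<longlongrightarrow> 0) at_bot"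
      by real_asymp
  qed
qed

text \<open>Integration by parts on the whole line, in the form in which it is used: \<open>G\<close> is the product, and
  its decay removes the boundary terms.\<close>

lemma integral_derivative_eq_0:
  fixes G g :: "real \<Rightarrow> real"
  assumes "\<And>x. (G has_real_derivative g x) (at x)" "continuous_on UNIV g"
    and "decays G" "integrable lborel g"
  shows "(\<integral>x. g x \<partial>lborel) = 0"
proof -
  have "(LBINT x=-\<infinity>..\<infinity>. g x) = 0 - 0"
  proof (rule interval_integral_FTC_integrable)
    show "(G has_vector_derivative g x) (at x)" for x
      using assms(1) by (simp add: has_real_derivative_iff_has_vector_derivative)
    show "isCont g x" for x
      using assms(2) by (simp add: continuous_on_eq_continuous_at)
    show "set_integrable lborel (einterval (-\<infinity>) \<infinity>) g"
      using assms(4) by (simp add: set_integrable_def)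
  qed (use decays_tendsto_0[OF assms(3)] in \<open>simp_all add: ereal_tendsto_simps\<close>)
  then show ?thesis
    by (simp add: interval_lebesgue_integral_def set_lebesgue_integral_def)
qed

lemma decays_powr:
  assumes "decays f" "1 \<le> p" "\<And>x. 0 \<le> f x"
  shows "decays (\<lambda>x. f x powr p)"
proof -
  obtain C where C: "C \<ge> 0" "\<And>x. \<bar>f x\<bar> \<le> C"
    using decays_bounded[OF assms(1)] by blast
  have "decays (\<lambda>x. f x powr (p - 1) * f x)"
    using assms C by (intro decays_mult_bounded[where M = "C powr (p - 1)"]) (auto intro!: powr_mono2)
  moreover have "f x powr (p - 1) * f x = f x powr p" for x
    using assms(3)[of x] by (cases "f x = 0") (auto simp: powr_diff)
  ultimately show ?thesis
    by simp
qed

lemma decays_powr_slope_mult: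
  assumes "decays f" "decays h" "1 \<le> p" "\<And>x. 0 \<le> f x"
  shows "decays (\<lambda>x. powr_slope p (f x) * h x)"
proof -
  obtain C where C: "C \<ge> 0" "\<And>x. \<bar>f x\<bar> \<le> C"
    using decays_bounded[OF assms(1)] by blast
  have "\<bar>powr_slope p (f x)\<bar> \<le> powr_slope p C" for x
    using assms C(2)[of x] by (simp add: powr_slope_nonneg powr_slope_mono)
  then show ?thesis
    by (rule decays_mult_bounded[OF assms(2)])
qed

section \<open>The transport term\<close>

lemma derivative_bounded_imp_linear_growth:
  fixes W :: "real \<Rightarrow> real"
  assumes "\<And>x. (W has_real_derivative w x) (at x)" "W 0 = 0" "\<And>x. \<bar>w x\<bar> \<le> M"
  shows "\<bar>W x\<bar> \<le> M * (1 + \<bar>x\<bar>)"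
proof -
  have "norm (W x - W 0) \<le> M * norm (x - 0)"
    by (rule field_differentiable_bound[of UNIV W w]) (use assms in auto)
  moreover have "0 \<le> M"
    using assms(3)[of 0] by simp
  ultimately show ?thesis
    using assms(2) by (simp add: algebra_simps)
qed

text \<open>Apply \<open>integral_derivative_eq_0\<close> to \<open>W * f powr p\<close>, whose derivative is
  \<open>(f + g) * f powr p + W * (f powr p)'\<close>. The product decays because \<open>W\<close>, having a bounded
  derivative and vanishing at zero, grows at most linearly.\<close>

lemma integral_transport:
  fixes f f1 g W :: "real \<Rightarrow> real"
  assumes p: "1 \<le> p" and f: "\<And>x. 0 \<le> f x" "\<And>x. (f has_real_derivative f1 x) (at x)"
    and f1: "continuous_on UNIV f1" and g: "continuous_on UNIV g"
    and dec: "decays f" "decays f1" "decays g"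
    and W: "\<And>x. (W has_real_derivative f x + g x) (at x)" "W 0 = 0"
  shows "integrable lborel (\<lambda>x. f x powr (p + 1))" (is ?A)
    and "integrable lborel (\<lambda>x. g x * f x powr p)" (is ?B)
    and "integrable lborel (\<lambda>x. W x * (powr_slope p (f x) * f1 x))" (is ?C)
    and "(\<integral>x. W x * (powr_slope p (f x) * f1 x) \<partial>lborel)
      = - (\<integral>x. f x powr (p + 1) \<partial>lborel) - (\<integral>x. g x * f x powr p \<partial>lborel)" (is ?D)
proof -
  have contf: "continuous_on UNIV f"
    using f(2) by (meson DERIV_continuous continuous_at_imp_continuous_on)
  have contW: "continuous_on UNIV W"
    using W(1) by (meson DERIV_continuous continuous_at_imp_continuous_on)
  have contp: "continuous_on UNIV (\<lambda>x. f x powr q)" if "1 \<le> q" for q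
    using f(1) that by (intro continuous_on_powr' contf) auto
  obtain C where C: "\<And>x. \<bar>f x\<bar> \<le> C"
    using decays_bounded[OF dec(1)] by blast
  obtain D where D: "\<And>x. \<bar>g x\<bar> \<le> D"
    using decays_bounded[OF dec(3)] by blast
  have "\<bar>f x + g x\<bar> \<le> C + D" for x
    using C[of x] D[of x] by linarith
  then have growth: "\<bar>W x\<bar> \<le> (C + D) * (1 + \<bar>x\<bar>)" for x
    by (rule derivative_bounded_imp_linear_growth[OF W])
  note decp = decays_powr[OF dec(1) _ f(1)]
  show ?A
    by (intro decays_integrable decp contp) (use p in auto)
  moreover show ?B
    by (intro decays_integrable decays_mult_bounded[where M = D] decp D continuous_on_mult contp g p)
  moreover show ?C
    by (intro decays_integrable decays_mult_linear_growth[where w = W, OF _ growth]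
        decays_powr_slope_mult dec p f(1) continuous_on_mult continuous_on_powr_slope f1 contf contW)
  ultimately have int: "integrable lborel
      (\<lambda>x. f x powr (p + 1) + g x * f x powr p + W x * (powr_slope p (f x) * f1 x))"
    by (intro Bochner_Integration.integrable_add)
  have add1: "y * y powr p = y powr (p + 1)" if "0 \<le> y" for y :: real
    using that by (cases "y = 0") (auto simp: powr_add)
  have "(\<integral>x. f x powr (p + 1) + g x * f x powr p + W x * (powr_slope p (f x) * f1 x) \<partial>lborel) = 0"
  proof (rule integral_derivative_eq_0[OF _ _ _ int])
    show "decays (\<lambda>x. W x * f x powr p)"
      by (intro decays_mult_linear_growth[where w = W, OF decp growth] p)
    show "continuous_on UNIV
        (\<lambda>x. f x powr (p + 1) + g x * f x powr p + W x * (powr_slope p (f x) * f1 x))"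
      by (intro continuous_intros contp g contW continuous_on_powr_slope contf f1 p f(1)) (use p in auto)
    fix x
    show "((\<lambda>x. W x * f x powr p) has_real_derivative
        f x powr (p + 1) + g x * f x powr p + W x * (powr_slope p (f x) * f1 x)) (at x)"
      using DERIV_mult[OF W(1)[of x] has_real_derivative_powr_chain[OF p f(2)[of x]]] f(1) add1[OF f(1)[of x]]
      by (simp add: algebra_simps)
  qed
  then show ?D
    using \<open>?A\<close> \<open>?B\<close> \<open>?C\<close> by simp
qed

section \<open>The viscous term\<close>

lemma nonneg_zero_imp_derivative_zero:
  fixes f :: "real \<Rightarrow> real"
  assumes "\<And>x. 0 \<le> f x" "(f has_real_derivative d) (at x)" "f x = 0"
  shows "d = 0"
  using DERIV_local_min[OF assms(2), of 1] assms by auto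

text \<open>Integrating the derivative of \<open>(f + \<epsilon>) powr (p - 1) * f1\<close> gives the identity with \<open>f + \<epsilon>\<close> in place
  of \<open>f\<close>. As \<open>\<epsilon>\<close> tends to zero, the integral containing \<open>f2\<close> converges by dominated convergence for
  every \<open>p > 1\<close>. For the other one, the exponent \<open>p - 2\<close> decides: if it is at most zero, the integrands
  increase and monotone convergence yields integrability of the limit as well; if it is
  positive, they are dominated by a multiple of \<open>f1\<^sup>2\<close>.\<close>

lemma integral_viscous:
  fixes f f1 f2 :: "real \<Rightarrow> real"
  assumes p: "1 < p" and f: "\<And>x. 0 \<le> f x" "\<And>x. (f has_real_derivative f1 x) (at x)"
    and f1: "\<And>x. (f1 has_real_derivative f2 x) (at x)" and f2: "continuous_on UNIV f2"
    and dec: "decays f" "decays f1" "decays f2"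
  shows "integrable lborel (dissipation_density p f)"
    and "(\<integral>x. powr_slope p (f x) * f2 x \<partial>lborel)
      = - (p * (p - 1) * (\<integral>x. dissipation_density p f x \<partial>lborel))"
proof -
  have contf: "continuous_on UNIV f"
    using f(2) by (meson DERIV_continuous continuous_at_imp_continuous_on)
  have contf1: "continuous_on UNIV f1"
    using f1 by (meson DERIV_continuous continuous_at_imp_continuous_on)
  obtain C where C: "0 \<le> C" "\<And>x. \<bar>f x\<bar> \<le> C"
    using decays_bounded[OF dec(1)] by blast
  obtain C1 where C1: "\<And>x. \<bar>f1 x\<bar> \<le> C1"
    using decays_bounded[OF dec(2)] by blast
  have fC: "f x \<le> C" for x
    using C(2)[of x] by simp
  define \<epsilon> where "\<epsilon> n = inverse (real (Suc n))" for n
  have \<epsilon>: "0 < \<epsilon> n" "\<epsilon> n \<le> 1" for n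
    by (auto simp: \<epsilon>_def field_simps)
  have \<epsilon>_lim: "\<epsilon> \<longlonglongrightarrow> 0"
    unfolding \<epsilon>_def by (rule LIMSEQ_inverse_real_of_nat)
  have pos: "0 < f x + \<epsilon> n" for x n
    using f(1)[of x] \<epsilon>(1)[of n] by linarith
  define A where "A n x = (f x + \<epsilon> n) powr (p - 1) * f2 x" for n x
  define B where "B n x = (f x + \<epsilon> n) powr (p - 2) * (f1 x)\<^sup>2" for n x
  have contq: "continuous_on UNIV (\<lambda>x. (f x + \<epsilon> n) powr q)" for n q
    using pos[of _ n]
    by (intro continuous_on_powr continuous_on_add continuous_on_const contf) (auto simp: less_le)
  have powr_le: "(f x + \<epsilon> n) powr q \<le> (C + 1) powr q" if "0 \<le> q" for x n q
    using that less_imp_le[OF pos[of x n]] fC[of x] \<epsilon>(2)[of n] by (intro powr_mono2) auto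
  \<comment> \<open>The second summand covers negative exponents, where it is the value at \<open>f x = 0\<close> that dominates.\<close>
  have powr_bound: "\<bar>(f x + \<epsilon> n) powr q\<bar> \<le> (C + 1) powr q + \<epsilon> n powr q" for x n q
  proof (cases "0 \<le> q")
    case True
    then show ?thesis
      using powr_le[OF True, of x n] by (simp add: add_increasing2)
  next
    case False
    then have "(f x + \<epsilon> n) powr q \<le> \<epsilon> n powr q"
      using f(1)[of x] \<epsilon>(1)[of n] by (intro powr_mono2') auto
    then show ?thesis
      by (simp add: add_increasing)
  qed
  have decsq: "decays (\<lambda>x. (f1 x)\<^sup>2)"
    using decays_mult_bounded[OF dec(2) C1] by (simp add: power2_eq_square)
  have A: "integrable lborel (A n)" for n
    unfolding A_def
    by (intro decays_integrable decays_mult_bounded[OF dec(3) powr_bound] continuous_intros contq f2)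
  have B: "integrable lborel (B n)" for n
    unfolding B_def
    by (intro decays_integrable decays_mult_bounded[OF decsq powr_bound] continuous_intros contq contf1)
  have parts: "(p - 1) * (\<integral>x. B n x \<partial>lborel) = - (\<integral>x. A n x \<partial>lborel)" for n
  proof -
    have "(\<integral>x. (p - 1) * B n x + A n x \<partial>lborel) = 0"
    proof (rule integral_derivative_eq_0)
      show "decays (\<lambda>x. (f x + \<epsilon> n) powr (p - 1) * f1 x)"
        by (rule decays_mult_bounded[OF dec(2) powr_bound])
      show "continuous_on UNIV (\<lambda>x. (p - 1) * B n x + A n x)"
        unfolding A_def B_def by (intro continuous_intros contq contf1 f2)
      show "integrable lborel (\<lambda>x. (p - 1) * B n x + A n x)"
        using A B by simp
      fix x
      have "((\<lambda>x. (f x + \<epsilon> n) powr (p - 1)) has_real_derivative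
          (p - 1) * (f x + \<epsilon> n) powr (p - 2) * f1 x) (at x)"
        using DERIV_chain2[OF has_real_derivative_powr[OF pos[of x n], of "p - 1"]
            DERIV_add[OF f(2)[of x] DERIV_const[of "\<epsilon> n"]]]
        by simp
      from DERIV_mult[OF this f1[of x]]
      show "((\<lambda>x. (f x + \<epsilon> n) powr (p - 1) * f1 x) has_real_derivative
          (p - 1) * B n x + A n x) (at x)"
        by (simp add: A_def B_def algebra_simps power2_eq_square)
    qed
    then show ?thesis
      using A B by simp
  qed
  have A_lim: "(\<lambda>n. \<integral>x. A n x \<partial>lborel) \<longlonglongrightarrow> (\<integral>x. f x powr (p - 1) * f2 x \<partial>lborel)"
  proof (rule integral_dominated_convergence[where w = "\<lambda>x. (C + 1) powr (p - 1) * \<bar>f2 x\<bar>"])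
    show "(\<lambda>x. f x powr (p - 1) * f2 x) \<in> borel_measurable lborel"
      using borel_measurable_continuous_onI[OF contf] borel_measurable_continuous_onI[OF f2] by simp
    show "A n \<in> borel_measurable lborel" for n
      using A by blast
    show "integrable lborel (\<lambda>x. (C + 1) powr (p - 1) * \<bar>f2 x\<bar>)"
      using decays_integrable[OF dec(3) f2] by simp
    show "AE x in lborel. (\<lambda>n. A n x) \<longlonglongrightarrow> f x powr (p - 1) * f2 x"
    proof (rule AE_I2)
      fix x
      have "(\<lambda>n. (f x + \<epsilon> n) powr (p - 1)) \<longlonglongrightarrow> (f x + 0) powr (p - 1)"
        by (intro tendsto_powr' tendsto_intros \<epsilon>_lim)
          (use p f(1) \<epsilon>(1) in \<open>auto intro!: add_nonneg_nonneg always_eventually less_imp_le\<close>)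
      then show "(\<lambda>n. A n x) \<longlonglongrightarrow> f x powr (p - 1) * f2 x"
        unfolding A_def by (intro tendsto_mult tendsto_const) simp
    qed
    show "AE x in lborel. norm (A n x) \<le> (C + 1) powr (p - 1) * \<bar>f2 x\<bar>" for n
      using p by (intro AE_I2) (auto simp: A_def abs_mult intro!: mult_right_mono powr_le)
  qed
  then have B_lim: "(\<lambda>n. \<integral>x. B n x \<partial>lborel)
      \<longlonglongrightarrow> - (\<integral>x. f x powr (p - 1) * f2 x \<partial>lborel) / (p - 1)"
  proof -
    have "(\<integral>x. B n x \<partial>lborel) = - (\<integral>x. A n x \<partial>lborel) / (p - 1)" for n
      using parts[of n] p by (simp add: field_simps)
    then show ?thesis
      using A_lim p by (auto intro!: tendsto_intros)
  qed
  have deriv_f: "deriv f x = f1 x" for x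
    using f(2) by (rule DERIV_imp_deriv)
  have dens: "dissipation_density p f x = f x powr (p - 2) * (f1 x)\<^sup>2" for x
    by (simp add: dissipation_density_def deriv_f)
  have dens_meas: "dissipation_density p f \<in> borel_measurable lborel"
    unfolding dens[abs_def]
    using borel_measurable_continuous_onI[OF contf] borel_measurable_continuous_onI[OF contf1] by simp
  \<comment> \<open>At a zero of \<open>f\<close>, the powers \<open>\<epsilon> n powr (p - 2)\<close> may tend to infinity, but there \<open>f1\<close> is zero
    because \<open>f\<close> has a minimum.\<close>
  have dens_lim: "(\<lambda>n. B n x) \<longlonglongrightarrow> dissipation_density p f x" for x
  proof (cases "f x = 0")
    case True
    then have "f1 x = 0"
      using nonneg_zero_imp_derivative_zero[OF f] by blast
    then show ?thesis
      by (simp add: B_def dens)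
  next
    case False
    have "(\<lambda>n. (f x + \<epsilon> n) powr (p - 2)) \<longlonglongrightarrow> (f x + 0) powr (p - 2)"
      by (intro tendsto_powr tendsto_intros \<epsilon>_lim) (use False in auto)
    then show ?thesis
      unfolding B_def dens by (intro tendsto_mult tendsto_const) simp
  qed
  have *: "integrable lborel (dissipation_density p f) \<and>
      (\<integral>x. dissipation_density p f x \<partial>lborel)
        = - (\<integral>x. f x powr (p - 1) * f2 x \<partial>lborel) / (p - 1)"
  proof (cases "p \<le> 2")
    case True
    have mono: "mono (\<lambda>n. B n x)" for x
    proof (rule monoI)
      fix m n :: nat
      assume "m \<le> n"
      then have "\<epsilon> n \<le> \<epsilon> m"
        by (simp add: \<epsilon>_def field_simps)
      then show "B m x \<le> B n x"
        unfolding B_def using True pos[of x n]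
        by (intro mult_right_mono powr_mono2') auto
    qed
    have nonneg: "0 \<le> B n x" for n x
      by (simp add: B_def)
    show ?thesis
      using integral_monotone_convergence_nonneg[OF B _ _ _ B_lim dens_meas] mono nonneg dens_lim
      by auto
  next
    case False
    have dom: "norm (B n x) \<le> (C + 1) powr (p - 2) * (f1 x)\<^sup>2" for n x
      using False by (auto simp: B_def abs_mult intro!: mult_right_mono powr_le)
    have w: "integrable lborel (\<lambda>x. (C + 1) powr (p - 2) * (f1 x)\<^sup>2)"
      by (intro integrable_mult_right decays_integrable decsq continuous_intros contf1)
    have Bm: "B n \<in> borel_measurable lborel" for n
      using B by blast
    have "integrable lborel (dissipation_density p f)"
      by (rule integrable_dominated_convergence[OF dens_meas Bm w]) (use dom in \<open>auto intro: AE_I2 dens_lim\<close>)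
    moreover have "(\<lambda>n. \<integral>x. B n x \<partial>lborel) \<longlonglongrightarrow> (\<integral>x. dissipation_density p f x \<partial>lborel)"
      by (rule integral_dominated_convergence[OF dens_meas Bm w]) (use dom in \<open>auto intro: AE_I2 dens_lim\<close>)
    ultimately show ?thesis
      using LIMSEQ_unique[OF _ B_lim] by blast
  qed
  then show "integrable lborel (dissipation_density p f)"
    by blast
  have "(\<integral>x. powr_slope p (f x) * f2 x \<partial>lborel) = p * (\<integral>x. f x powr (p - 1) * f2 x \<partial>lborel)"
    using p by (simp add: powr_slope_def mult.assoc)
  then show "(\<integral>x. powr_slope p (f x) * f2 x \<partial>lborel)
      = - (p * (p - 1) * (\<integral>x. dissipation_density p f x \<partial>lborel))"
    using * p by simp
qed

text \<open>For \<open>p = 1\<close> the integrand is \<open>f2\<close> alone, which integrates to zero; this agrees with the convention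
  that the dissipation vanishes in that case.\<close>

lemma integral_powr_slope_second_derivative:
  fixes f f1 f2 :: "real \<Rightarrow> real"
  assumes p: "1 \<le> p" and f: "\<And>x. 0 \<le> f x" "\<And>x. (f has_real_derivative f1 x) (at x)"
    and f1: "\<And>x. (f1 has_real_derivative f2 x) (at x)" and f2: "continuous_on UNIV f2"
    and dec: "decays f" "decays f1" "decays f2"
  shows "\<nu> * (\<integral>x. powr_slope p (f x) * f2 x \<partial>lborel) = - dissipation \<nu> p f"
proof (cases "p = 1")
  case True
  then show ?thesis
    using integral_derivative_eq_0[OF f1 f2 dec(2) decays_integrable[OF dec(3) f2]]
    by (simp add: powr_slope_def dissipation_def)
next
  case False
  then show ?thesis
    using integral_viscous(2)[OF _ f f1 f2 dec] p by (simp add: dissipation_def)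
qed

section \<open>Regularity of smooth solutions\<close>

lemma smooth_on_strip_ddx: "smooth_on_strip I f \<Longrightarrow> smooth_on_strip I (ddx f)"
  unfolding smooth_on_strip_def by (metis C_diff.simps(2))

lemma smooth_on_strip_ddt: "smooth_on_strip I f \<Longrightarrow> smooth_on_strip I (ddt I f)"
  unfolding smooth_on_strip_def by (metis C_diff.simps(2))

lemma smooth_on_strip_continuous:
  assumes "smooth_on_strip I f" "t \<in> I"
  shows "continuous_on UNIV (\<lambda>x. f x t)"
proof -
  have "continuous_on (UNIV \<times> I) (\<lambda>(x, t). f x t)"
    using assms(1) unfolding smooth_on_strip_def by (metis C_diff.simps(1))
  then have "continuous_on UNIV ((\<lambda>(x, t). f x t) \<circ> (\<lambda>x. (x, t)))"
    using assms(2) by (intro continuous_on_compose continuous_intros) (auto elim: continuous_on_subset)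
  then show ?thesis
    by (simp add: comp_def)
qed

lemma smooth_on_strip_has_ddx:
  assumes "smooth_on_strip I f" "t \<in> I"
  shows "((\<lambda>y. f y t) has_real_derivative ddx f x t) (at x)"
proof -
  have "C_diff (Suc 0) I f"
    using assms(1) unfolding smooth_on_strip_def by blast
  then have "(\<lambda>y. f y t) differentiable (at x)"
    using assms(2) by simp
  then show ?thesis
    unfolding ddx_def by (simp add: DERIV_deriv_iff_real_differentiable)
qed

lemma smooth_on_strip_has_ddt:
  assumes "smooth_on_strip I f" "t \<in> I"
  shows "((\<lambda>s. f x s) has_real_derivative ddt I f x t) (at t within I)"
proof -
  have "C_diff (Suc 0) I f"
    using assms(1) unfolding smooth_on_strip_def by blast
  then have "(\<lambda>s. f x s) differentiable (at t within I)"
    using assms(2) by simp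
  then show ?thesis
    unfolding ddt_def has_real_derivative_iff_has_vector_derivative
    by (simp add: vector_derivative_works)
qed

lemma rapidly_decaying_imp_decays:
  assumes "rapidly_decaying I f" "t \<in> I"
  shows "decays (\<lambda>x. f x t)" "decays (\<lambda>x. ddx f x t)" "decays (\<lambda>x. ddx (ddx f) x t)"
proof -
  have *: "decays (\<lambda>x. ((ddx ^^ m) f) x t)" for m
    unfolding decays_def
  proof
    fix N
    have "compact {t} \<and> {t} \<subseteq> I"
      using assms(2) by simp
    then have "\<exists>C. \<forall>x. \<forall>s\<in>{t}. \<bar>x\<bar> ^ N * \<bar>((ddt I ^^ 0) ((ddx ^^ m) f)) x s\<bar> \<le> C"
      using assms(1)[unfolded rapidly_decaying_def, rule_format, of "{t}" N 0 m] by simp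
    then show "\<exists>C. \<forall>x. \<bar>x\<bar> ^ N * \<bar>((ddx ^^ m) f) x t\<bar> \<le> C"
      by simp
  qed
  show "decays (\<lambda>x. f x t)" "decays (\<lambda>x. ddx f x t)" "decays (\<lambda>x. ddx (ddx f) x t)"
    using *[of 0] *[of 1] *[of 2] by (simp_all add: numeral_2_eq_2)
qed

text \<open>Provides the dominating functions for differentiation in time, uniform over a compact time
  interval.\<close>

lemma rapidly_decaying_uniform_bound:
  assumes "rapidly_decaying I f" "compact K" "K \<subseteq> I"
  obtains C where "\<And>x s. s \<in> K \<Longrightarrow> \<bar>((ddt I ^^ l) f) x s\<bar> \<le> C * inverse (1 + x\<^sup>2)"
proof -
  have "\<exists>C. \<forall>x. \<forall>s\<in>K. \<bar>x\<bar> ^ N * \<bar>((ddt I ^^ l) ((ddx ^^ 0) f)) x s\<bar> \<le> C" for N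
    using assms unfolding rapidly_decaying_def by blast
  then obtain C D where "\<forall>x. \<forall>s\<in>K. \<bar>x\<bar> ^ 0 * \<bar>((ddt I ^^ l) f) x s\<bar> \<le> C"
      "\<forall>x. \<forall>s\<in>K. \<bar>x\<bar> ^ 2 * \<bar>((ddt I ^^ l) f) x s\<bar> \<le> D"
    unfolding funpow_0 by meson
  then show thesis
    by (intro that[of "C + D"] le_inverse_1_plus_square) auto
qed

section \<open>The power balance\<close>

text \<open>The decay bounds are uniform only on compact sets of times. So the differentiation takes place
  in an interval \<open>{0..b}\<close> with \<open>t < b\<close> inside the time interval, and \<open>{0..b}\<close> is a neighbourhood of
  \<open>t\<close> relative to the time interval, also for \<open>t = 0\<close>.\<close>

lemma has_real_derivative_integral_powr:
  assumes smooth: "smooth_on_strip (time_interval T) f"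
    and decay: "rapidly_decaying (time_interval T) f"
    and nonneg: "\<And>x s. s \<in> time_interval T \<Longrightarrow> 0 \<le> f x s"
    and p: "1 \<le> p" and t: "t \<in> time_interval T"
  shows "((\<lambda>s. \<integral>x. f x s powr p \<partial>lborel) has_real_derivative
      (\<integral>x. powr_slope p (f x t) * ddt (time_interval T) f x t \<partial>lborel)) (at t within time_interval T)"
proof -
  let ?I = "time_interval T"
  obtain b where b: "t < b" "ereal b < T"
    using t ereal_dense2[of t T] unfolding time_interval_def by auto
  have sub: "{0..b} \<subseteq> ?I"
    using b(2) unfolding time_interval_def by (auto intro: le_less_trans[of _ "ereal b"])
  have t0: "0 \<le> t"
    using t by (simp add: time_interval_def)
  obtain C where C: "\<And>x s. s \<in> {0..b} \<Longrightarrow> \<bar>f x s\<bar> \<le> C * inverse (1 + x\<^sup>2)"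
    using rapidly_decaying_uniform_bound[OF decay compact_Icc sub, where l = 0] by auto
  obtain D where D: "\<And>x s. s \<in> {0..b} \<Longrightarrow> \<bar>ddt ?I f x s\<bar> \<le> D * inverse (1 + x\<^sup>2)"
    using rapidly_decaying_uniform_bound[OF decay compact_Icc sub, where l = 1] by auto
  have C0: "0 \<le> C"
    using C[of t 0] b t0 by simp
  have fC: "f x s \<le> C" if "s \<in> {0..b}" for x s
  proof -
    have "C * inverse (1 + x\<^sup>2) \<le> C * 1"
      using C0 by (intro mult_left_mono) (auto simp: inverse_le_1_iff)
    then show ?thesis
      using C[OF that, of x] by simp
  qed
  have contf: "continuous_on UNIV (\<lambda>x. f x s)" if "s \<in> ?I" for s
    using smooth_on_strip_continuous[OF smooth that] .
  have "((\<lambda>s. \<integral>x. f x s powr p \<partial>lborel) has_real_derivative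
      (\<integral>x. powr_slope p (f x t) * ddt ?I f x t \<partial>lborel)) (at t within {0..b})"
  proof (rule has_real_derivative_integral_dominated
      [where B = "\<lambda>x. (powr_slope p C * D) * inverse (1 + x\<^sup>2)"])
    show "t \<in> {0..b}"
      using b t0 by simp
    show "integrable lborel (\<lambda>x. (powr_slope p C * D) * inverse (1 + x\<^sup>2))"
      by (rule integrable_inverse_1_plus_square_lborel)
    have "continuous_on UNIV (\<lambda>x. powr_slope p (f x t) * ddt ?I f x t)"
      by (intro continuous_on_mult continuous_on_powr_slope p contf t nonneg
          smooth_on_strip_continuous[OF smooth_on_strip_ddt[OF smooth] t])
    then show "(\<lambda>x. powr_slope p (f x t) * ddt ?I f x t) \<in> borel_measurable lborel"
      using borel_measurable_continuous_onI by simp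
    fix s assume s: "s \<in> {0..b}"
    then have sI: "s \<in> ?I"
      using sub by blast
    show "integrable lborel (\<lambda>x. f x s powr p)"
      using p sI nonneg
      by (intro decays_integrable decays_powr rapidly_decaying_imp_decays[OF decay]
          continuous_on_powr' contf continuous_intros) auto
    fix x
    show "((\<lambda>s. f x s powr p) has_real_derivative powr_slope p (f x s) * ddt ?I f x s)
        (at s within {0..b})"
      using sub s sI
      by (intro has_real_derivative_powr_chain p nonneg
          has_field_derivative_subset[OF smooth_on_strip_has_ddt[OF smooth]]) auto
    have "\<bar>powr_slope p (f x s) * ddt ?I f x s\<bar>
        \<le> powr_slope p C * (D * inverse (1 + x\<^sup>2))"
      unfolding abs_mult
      by (intro mult_mono D s)
        (use p nonneg[OF sI] fC[OF s] in \<open>auto simp: powr_slope_nonneg powr_slope_mono\<close>)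
    then show "\<bar>powr_slope p (f x s) * ddt ?I f x s\<bar> \<le> (powr_slope p C * D) * inverse (1 + x\<^sup>2)"
      by (simp add: mult.assoc)
  qed auto
  moreover have "at t within ?I = at t within {0..b}"
    by (rule at_within_nhd[where S = "{..<b}"])
      (use b sub in \<open>auto simp: time_interval_def\<close>)
  ultimately show ?thesis
    by simp
qed

text \<open>The reaction term contributes \<open>p * \<integral> f powr (p + 1)\<close> and the compression \<open>f + g\<close> of the drift
  contributes one more such integral and the interaction with the other component.\<close>

lemma power_balance:
  assumes sol: "smooth_solution \<nu> T a V"
    and "\<forall>i. \<forall>t\<in>time_interval T. \<forall>x. 0 \<le> a i x t"
    and kj: "k \<noteq> j" and p: "1 \<le> p" and t: "t \<in> time_interval T"
  shows "integrable lborel (\<lambda>x. a j x t powr p)"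
    and "integrable lborel (\<lambda>x. a j x t powr (p + 1))"
    and "integrable lborel (\<lambda>x. a k x t * a j x t powr p)"
    and "p \<noteq> 1 \<Longrightarrow> integrable lborel (dissipation_density p (\<lambda>x. a j x t))"
    and "((\<lambda>s. \<integral>x. a j x s powr p \<partial>lborel) has_real_derivative
        (p + 1) * (\<integral>x. a j x t powr (p + 1) \<partial>lborel)
          + (\<integral>x. a k x t * a j x t powr p \<partial>lborel) - dissipation \<nu> p (\<lambda>x. a j x t))
        (at t within time_interval T)"
proof -
  let ?I = "time_interval T"
  have nonneg: "0 \<le> a i x s" if "s \<in> ?I" for i x s
    using assms(2) that by blast
  let ?f = "\<lambda>x. a j x t" and ?g = "\<lambda>x. a k x t" and ?W = "\<lambda>x. V x t"
  let ?f1 = "\<lambda>x. ddx (a j) x t" and ?f2 = "\<lambda>x. ddx (ddx (a j)) x t"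
  have smooth: "smooth_on_strip ?I (a i)" and decay: "rapidly_decaying ?I (a i)" for i
    using sol unfolding smooth_solution_def by auto
  have f: "\<And>x. 0 \<le> ?f x" "\<And>x. (?f has_real_derivative ?f1 x) (at x)"
    using nonneg smooth_on_strip_has_ddx[OF smooth] t by auto
  have f1: "\<And>x. (?f1 has_real_derivative ?f2 x) (at x)"
    using smooth_on_strip_has_ddx[OF smooth_on_strip_ddx[OF smooth]] t by auto
  have cont: "continuous_on UNIV ?f" "continuous_on UNIV ?f1" "continuous_on UNIV ?f2"
    "continuous_on UNIV ?g"
    using smooth t by (auto intro: smooth_on_strip_continuous smooth_on_strip_ddx)
  note dec = rapidly_decaying_imp_decays[OF decay[of j] t]
  note decg = rapidly_decaying_imp_decays(1)[OF decay[of k] t]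
  \<comment> \<open>As there are two signs only, \<open>j\<close> and \<open>k\<close> exhaust them.\<close>
  have sum: "a Plus x t + a Minus x t = ?f x + ?g x" for x
    using kj by (cases j; cases k) auto
  have W: "\<And>x. (?W has_real_derivative ?f x + ?g x) (at x)" "?W 0 = 0"
    using sol t unfolding smooth_solution_def sum[symmetric] by auto
  have pde: "ddt ?I (a j) x t = (?f x)\<^sup>2 + \<nu> * ?f2 x - ?W x * ?f1 x" for x
    using sol t unfolding smooth_solution_def by (smt (verit))
  note transport = integral_transport[OF p f cont(2) cont(4) dec(1,2) decg W]
  show "integrable lborel (\<lambda>x. ?f x powr p)"
    using p f(1)
    by (intro decays_integrable decays_powr dec continuous_on_powr' cont continuous_intros) auto
  show "integrable lborel (\<lambda>x. ?f x powr (p + 1))" "integrable lborel (\<lambda>x. ?g x * ?f x powr p)"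
    using transport by auto
  show "integrable lborel (dissipation_density p ?f)" if "p \<noteq> 1"
    using integral_viscous(1)[OF _ f f1 cont(3) dec] p that by auto
  have slope_sq: "powr_slope p y * y\<^sup>2 = p * y powr (p + 1)" if "0 \<le> y" for y
  proof (cases "y = 0")
    case False
    then show ?thesis
      using that by (simp add: powr_slope_def powr_add powr_diff power2_eq_square)
  qed simp
  have split: "powr_slope p (?f x) * ddt ?I (a j) x t
      = p * ?f x powr (p + 1) + \<nu> * (powr_slope p (?f x) * ?f2 x)
        - ?W x * (powr_slope p (?f x) * ?f1 x)" for x
    unfolding pde slope_sq[OF f(1), symmetric] by (simp add: algebra_simps)
  have int2: "integrable lborel (\<lambda>x. powr_slope p (?f x) * ?f2 x)"
    by (intro decays_integrable decays_powr_slope_mult dec p f continuous_on_mult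
        continuous_on_powr_slope cont)
  have "(\<integral>x. powr_slope p (?f x) * ddt ?I (a j) x t \<partial>lborel)
      = (p + 1) * (\<integral>x. ?f x powr (p + 1) \<partial>lborel)
        + (\<integral>x. ?g x * ?f x powr p \<partial>lborel) - dissipation \<nu> p ?f"
    unfolding split
    using transport int2 integral_powr_slope_second_derivative[OF p f f1 cont(3) dec, of \<nu>]
    by (simp add: algebra_simps)
  then show "((\<lambda>s. \<integral>x. a j x s powr p \<partial>lborel) has_real_derivative
        (p + 1) * (\<integral>x. a j x t powr (p + 1) \<partial>lborel)
          + (\<integral>x. a k x t * a j x t powr p \<partial>lborel) - dissipation \<nu> p (\<lambda>x. a j x t))
        (at t within ?I)"
    using has_real_derivative_integral_powr[OF smooth decay nonneg p t, of j] by simp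
qed

theorem proposition4p5:
  fixes \<nu> :: real and T :: ereal
    and a :: "sign \<Rightarrow> real \<Rightarrow> real \<Rightarrow> real" and V :: "real \<Rightarrow> real \<Rightarrow> real"
    and j k :: sign
  assumes "\<nu> \<ge> 0" and "T > 0"
    and "smooth_solution \<nu> T a V"
    and "\<And>i t x. t \<in> time_interval T \<Longrightarrow> a i (- x) t = a i x t"
    and "\<And>i t x. t \<in> time_interval T \<Longrightarrow> a i x t \<ge> 0"
    and "\<And>i t. t \<in> time_interval T \<Longrightarrow> antimono_on {0<..} (\<lambda>x. a i x t)"
    and "k \<noteq> j"
  shows "(\<forall>p\<ge>1. \<forall>t\<in>time_interval T.
            integrable lborel (\<lambda>x. a j x t powr p) \<and>
            integrable lborel (\<lambda>x. a j x t powr (p + 1)) \<and>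
            integrable lborel (\<lambda>x. a k x t * a j x t powr p) \<and>
            (p \<noteq> 1 \<and> \<nu> \<noteq> 0 \<longrightarrow> integrable lborel (dissipation_density p (\<lambda>x. a j x t))) \<and>
            (\<exists>D. ((\<lambda>s. \<integral>x. a j x s powr p \<partial>lborel) has_real_derivative D)
                    (at t within time_interval T) \<and>
                 D + dissipation \<nu> p (\<lambda>x. a j x t)
                   = (p + 1) * (\<integral>x. a j x t powr (p + 1) \<partial>lborel)
                     + (\<integral>x. a k x t * a j x t powr p \<partial>lborel))) \<and>
         (\<forall>t\<in>time_interval T.
            integrable lborel (\<lambda>x. a j x t) \<and>
            integrable lborel (\<lambda>x. (a j x t)\<^sup>2) \<and>
            integrable lborel (\<lambda>x. a j x t * a k x t) \<and>
            ((\<lambda>s. \<integral>x. a j x s \<partial>lborel) has_real_derivative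
               (2 * (\<integral>x. (a j x t)\<^sup>2 \<partial>lborel) + (\<integral>x. a j x t * a k x t \<partial>lborel)))
              (at t within time_interval T))"
proof -
  have nonneg: "\<forall>i. \<forall>t\<in>time_interval T. \<forall>x. 0 \<le> a i x t"
    using assms(5) by blast
  show ?thesis
  proof (intro conjI allI impI ballI)
    fix p t :: real
    assume p: "1 \<le> p" and t: "t \<in> time_interval T"
    note balance = power_balance[OF assms(3) nonneg assms(7) p t]
    show "integrable lborel (\<lambda>x. a j x t powr p)"
      and "integrable lborel (\<lambda>x. a j x t powr (p + 1))"
      and "integrable lborel (\<lambda>x. a k x t * a j x t powr p)"
      using balance(1-3) by auto
    show "integrable lborel (dissipation_density p (\<lambda>x. a j x t))" if "p \<noteq> 1 \<and> \<nu> \<noteq> 0"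
      using balance(4) that by auto
    show "\<exists>D. ((\<lambda>s. \<integral>x. a j x s powr p \<partial>lborel) has_real_derivative D)
                  (at t within time_interval T) \<and>
               D + dissipation \<nu> p (\<lambda>x. a j x t)
                 = (p + 1) * (\<integral>x. a j x t powr (p + 1) \<partial>lborel)
                   + (\<integral>x. a k x t * a j x t powr p \<partial>lborel)"
      by (rule exI, rule conjI, rule balance(5), rule diff_add_cancel)
  next
    fix t :: real
    assume t: "t \<in> time_interval T"
    note balance = power_balance[OF assms(3) nonneg assms(7) order_refl t]
    have powr_1: "a i x s powr 1 = a i x s" if "s \<in> time_interval T" for i x s
      using assms(5)[OF that] by simp
    have powr_2: "a i x t powr (1 + 1) = (a i x t)\<^sup>2" for i x
      using assms(5)[OF t] by simp
    note balance = balance[unfolded powr_1[OF t] powr_2]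
    show "integrable lborel (\<lambda>x. a j x t)" "integrable lborel (\<lambda>x. (a j x t)\<^sup>2)"
      and "integrable lborel (\<lambda>x. a j x t * a k x t)"
      using balance(1-3) by (simp_all add: mult.commute)
    have "((\<lambda>s. \<integral>x. a j x s powr 1 \<partial>lborel) has_real_derivative
        (2 * (\<integral>x. (a j x t)\<^sup>2 \<partial>lborel) + (\<integral>x. a j x t * a k x t \<partial>lborel)))
        (at t within time_interval T)"
      using balance(5) by (simp add: dissipation_def mult.commute)
    then show "((\<lambda>s. \<integral>x. a j x s \<partial>lborel) has_real_derivative
        (2 * (\<integral>x. (a j x t)\<^sup>2 \<partial>lborel) + (\<integral>x. a j x t * a k x t \<partial>lborel)))
        (at t within time_interval T)"
      by (rule has_field_derivative_transform_within[where d = 1]) (use t assms(5) in auto)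
  qed
qed

end
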